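(* Let $\mathsf{M}$ be a matroid (possibly with loops and coloops) with ground set $[n]$ and rank $r$. Then $$\mathbf{1}_{\mathscr{P}(\mathsf{M})}=\sum_{\mathrm{C}\in\mathcal{C}_{\mathscr{Z}}(\mathsf{M}),\ \mathrm{C}\neq\widehat{\mathbf{1}}}\lambda_{\mathrm{C}}\,\mathbf{1}_{\mathscr{P}(\mathsf{S}_{\mathrm{C}})}.$$
   Context: The base polytope $\mathscr{P}(\mathsf{M})\subseteq\mathbb{R}^n$ is the convex hull of the $0/1$ indicator vectors of the bases of $\mathsf{M}$; $\mathbf{1}_X$ is the indicator function of $X\subseteq\mathbb{R}^n$. Let $\mathscr{Z}(\mathsf{M})$ be the lattice of cyclic flats of $\mathsf{M}$. For a finite poset $P$ with a minimum and a maximum, its chain lattice $\mathcal{C}_P$ consists of all chains of $P$ containing the minimum and maximum of $P$, ordered by inclusion, together with an added top element $\widehat{\mathbf{1}}$; set $\mathcal{C}_{\mathscr{Z}}(\mathsf{M})=\mathcal{C}_{\mathscr{Z}(\mathsf{M})}$. For $\mathrm{C}\in\mathcal{C}_{\mathscr{Z}}(\mathsf{M})$ let $\lambda_{\mathrm{C}}=-\mu(\mathrm{C},\widehat{\mathbf{1}})$, where $\mu$ is the Möbius function of $\mathcal{C}_{\mathscr{Z}}(\mathsf{M})$. For $\mathrm{C}\neq\widehat{\mathbf{1}}$ (a chain of cyclic flats of $\mathsf{M}$), $\mathsf{S}_{\mathrm{C}}$ denotes the unique matroid on $[n]$ (necessarily a Schubert matroid, i.e. one whose lattice of cyclic flats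 is a chain) whose cyclic flats are exactly the members of $\mathrm{C}$, with the same ranks as in $\mathsf{M}$. *)

theory Defs
  imports "HOL-Analysis.Analysis" "HOL-Library.Lattice_Constructions"
begin

section \<open>Matroids\<close>

text \<open>
  A matroid is given by its ground set \<open>E\<close> and its family \<open>\<I>\<close> of independent sets.
  On a fixed ground set, equality of matroids is equality of these families.
\<close>

locale matroid =
  fixes E :: "'a set" and \<I> :: "'a set set"
  assumes finite_ground: "finite E"
    and indep_subset_ground: "X \<in> \<I> \<Longrightarrow> X \<subseteq> E"
    and empty_indep: "{} \<in> \<I>"
    and indep_subset: "X \<in> \<I> \<Longrightarrow> Y \<subseteq> X \<Longrightarrow> Y \<in> \<I>"
    and augment: "X \<in> \<I> \<Longrightarrow> Y \<in> \<I> \<Longrightarrow> card X < card Y \<Longrightarrow> \<exists>y\<in>Y - X. insert y X \<in> \<I>"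

definition bases :: "'a set set \<Rightarrow> 'a set set" where
  "bases \<I> = {B \<in> \<I>. \<forall>X\<in>\<I>. B \<subseteq> X \<longrightarrow> X = B}"

definition rank_of :: "'a set set \<Rightarrow> 'a set \<Rightarrow> nat" where
  "rank_of \<I> X = Max (card ` {Y \<in> \<I>. Y \<subseteq> X})"

definition circuits :: "'a set \<Rightarrow> 'a set set \<Rightarrow> 'a set set" where
  "circuits E \<I> = {C. C \<subseteq> E \<and> C \<notin> \<I> \<and> (\<forall>X. X \<subset> C \<longrightarrow> X \<in> \<I>)}"

definition flats :: "'a set \<Rightarrow> 'a set set \<Rightarrow> 'a set set" where
  "flats E \<I> = {F. F \<subseteq> E \<and> (\<forall>e\<in>E - F. rank_of \<I> F < rank_of \<I> (insert e F))}"

definition cyclic_flats :: "'a set \<Rightarrow> 'a set set \<Rightarrow> 'a set set" where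
  "cyclic_flats E \<I> = {F \<in> flats E \<I>. \<exists>\<C> \<subseteq> circuits E \<I>. F = \<Union> \<C>}"

text \<open>
  For a matroid whose ground set \<open>E\<close> is not all of the index type, the polytope lies in the
  coordinate subspace of vectors vanishing outside \<open>E\<close>; this also admits \<open>E = {}\<close>.
\<close>

definition base_polytope :: "'n::finite set set \<Rightarrow> (real ^ 'n) set" where
  "base_polytope \<I> = convex hull ((\<lambda>B. \<chi> i. indicator B i) ` bases \<I>)"

text \<open>
  The matroid on \<open>E\<close> whose cyclic flats are the members of the chain \<open>C\<close> of cyclic flats of
  \<open>(E, \<I>)\<close>, with the ranks they have in \<open>(E, \<I>)\<close>.
\<close>

definition schubert :: "'a set \<Rightarrow> 'a set set \<Rightarrow> 'a set set \<Rightarrow> 'a set set" where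
  "schubert E \<I> C =
    (THE \<J>. matroid E \<J> \<and> cyclic_flats E \<J> = C \<and> (\<forall>F\<in>C. rank_of \<J> F = rank_of \<I> F))"


section \<open>Moebius functions and chain lattices\<close>

text \<open>
  The Moebius function of the finite poset with carrier \<open>P\<close> and the order of the type; it is set
  to \<open>0\<close> at \<open>(x, y)\<close> unless \<open>x \<le> y\<close> holds in \<open>P\<close>.
\<close>

function mobius :: "'a::order set \<Rightarrow> 'a \<Rightarrow> 'a \<Rightarrow> int" where
  "mobius P x y =
    (if finite P \<and> x \<in> P \<and> y \<in> P \<and> x \<le> y
     then if x = y then 1 else - (\<Sum>z | z \<in> P \<and> x \<le> z \<and> z < y. mobius P x z)
     else 0)"
  by pat_completeness auto
termination
proof (relation "Wellfounded.measure (\<lambda>(P, x, y). card {z \<in> P. z < y})", goal_cases)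
  case (2 P x y z)
  then have "{w \<in> P. w < z} \<subset> {w \<in> P. w < y}"
    by (auto intro: less_trans)
  with 2 show ?case
    by (auto intro!: psubset_card_mono)
qed simp

declare mobius.simps [simp del]

definition bounded_chains :: "'a::order set \<Rightarrow> 'a set set" where
  "bounded_chains P =
    {C. pred_on.chain P (<) C \<and> (\<exists>m\<in>C. \<forall>p\<in>P. m \<le> p) \<and> (\<exists>m\<in>C. \<forall>p\<in>P. p \<le> m)}"

text \<open>
  The chains are ordered by inclusion, and \<^term>\<open>top.Top\<close> is above all of them; this is the order
  on the type \<^typ>\<open>'a set top\<close>.
\<close>

definition chain_lattice :: "'a::order set \<Rightarrow> 'a set top set" where
  "chain_lattice P = insert top.Top (top.Value ` bounded_chains P)"

definition lam :: "'a set \<Rightarrow> 'a set set \<Rightarrow> 'a set set \<Rightarrow> int" where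
  "lam E \<I> C = - mobius (chain_lattice (cyclic_flats E \<I>)) (top.Value C) top.Top"

end

theory Submission
  imports Defs
begin

text \<open>
  A point \<open>x\<close> of the unit cube with coordinate sum \<open>r\<close> lies in the base polytope iff
  \<open>x(F) \<le> rk(F)\<close> for all cyclic flats \<open>F\<close>. Hence it lies in the polytope of \<open>S\<^sub>C\<close> iff the chain
  \<open>C\<close> avoids the set \<open>V\<close> of cyclic flats of the given matroid that violate this. As the
  coefficients of all chains containing a given chain sum to \<open>1\<close>, inclusion-exclusion turns the
  sum over the chains avoiding \<open>V\<close> into \<open>\<Sum>\<^sub>D (- 1)\<^bsup>card D\<^esup>\<close> over all chains \<open>D\<close> in \<open>V\<close>. If \<open>V\<close> is
  nonempty and \<open>m\<close> minimizes \<open>rk(F) - x(F)\<close>, then by submodularity \<open>V\<close> is closed under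
  \<open>F \<mapsto> F \<or> m\<close>; so the order complex of \<open>V\<close> is contractible and the sum vanishes.
\<close>

section \<open>Rank, closure and cyclic flats\<close>

context matroid
begin

section \<open>Rank function, extension to bases, submodularity\<close>

lemma finite_indep: "finite \<I>"
  using finite_ground indep_subset_ground by (auto intro: finite_subset[of _ "Pow E"])

lemma finite_indep_set: "X \<in> \<I> \<Longrightarrow> finite X"
  using finite_ground indep_subset_ground finite_subset by blast

lemma card_le_rank: "Y \<in> \<I> \<Longrightarrow> Y \<subseteq> X \<Longrightarrow> card Y \<le> rank_of \<I> X"
  unfolding rank_of_def using finite_indep by (intro Max_ge) auto

lemma rank_attained: "\<exists>Y\<in>\<I>. Y \<subseteq> X \<and> card Y = rank_of \<I> X"
proof -
  have "rank_of \<I> X \<in> card ` {Y \<in> \<I>. Y \<subseteq> X}"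
    unfolding rank_of_def using finite_indep empty_indep by (intro Max_in) auto
  then show ?thesis by auto
qed

lemma rank_leI: "(\<And>Y. Y \<in> \<I> \<Longrightarrow> Y \<subseteq> X \<Longrightarrow> card Y \<le> n) \<Longrightarrow> rank_of \<I> X \<le> n"
  by (metis rank_attained)

lemma rank_mono: "X \<subseteq> Y \<Longrightarrow> rank_of \<I> X \<le> rank_of \<I> Y"
  by (rule rank_leI) (auto intro: card_le_rank)

lemma rank_le_card: "finite X \<Longrightarrow> rank_of \<I> X \<le> card X"
  by (rule rank_leI) (auto intro: card_mono)

lemma rank_indep: "X \<in> \<I> \<Longrightarrow> rank_of \<I> X = card X"
  using card_le_rank[of X X] rank_le_card[of X] finite_indep_set by fastforce

lemma indep_iff_rank:
  assumes "finite X"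
  shows "X \<in> \<I> \<longleftrightarrow> card X \<le> rank_of \<I> X"
proof
  assume "card X \<le> rank_of \<I> X"
  moreover obtain Y where "Y \<in> \<I>" "Y \<subseteq> X" "card Y = rank_of \<I> X"
    using rank_attained by blast
  ultimately show "X \<in> \<I>"
    using assms card_seteq by metis
qed (simp add: rank_indep)

text \<open>A largest independent set between \<open>Y\<close> and \<open>X\<close> already has full
  rank: otherwise augmenting it from a basis of \<open>X\<close> would give a larger one.\<close>

lemma extend_indep:
  assumes "Y \<in> \<I>" "Y \<subseteq> X"
  obtains Z where "Z \<in> \<I>" "Y \<subseteq> Z" "Z \<subseteq> X" "card Z = rank_of \<I> X"
proof -
  let ?S = "{Z \<in> \<I>. Y \<subseteq> Z \<and> Z \<subseteq> X}"
  have fin: "finite (card ` ?S)" and ne: "card ` ?S \<noteq> {}"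
    using finite_indep assms by auto
  obtain Z where Z: "Z \<in> ?S" "card Z = Max (card ` ?S)"
    using Max_in[OF fin ne] by auto
  have "card Z = rank_of \<I> X"
  proof (rule ccontr)
    assume "card Z \<noteq> rank_of \<I> X"
    then have less: "card Z < rank_of \<I> X" using card_le_rank[of Z X] Z by auto
    obtain B where B: "B \<in> \<I>" "B \<subseteq> X" "card B = rank_of \<I> X" using rank_attained by blast
    obtain y where y: "y \<in> B - Z" "insert y Z \<in> \<I>" using augment[of Z B] Z B less by auto
    then have "insert y Z \<in> ?S" using B Z by auto
    then have "card (insert y Z) \<le> card Z" unfolding Z(2) by (intro Max_ge[OF fin] imageI)
    moreover have "finite Z" using Z finite_indep_set by blast
    ultimately show False using y by simp
  qed
  then show ?thesis using that Z by blast
qed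

text \<open>Extend a basis \<open>I\<close> of the intersection to a basis \<open>J\<close> of the
  union. The traces of \<open>J\<close> on \<open>A\<close> and \<open>B\<close> are independent,
  and together they count \<open>J\<close> once and its part in \<open>A \<inter> B\<close> a second
  time.\<close>

lemma rank_submodular:
  "rank_of \<I> (A \<union> B) + rank_of \<I> (A \<inter> B) \<le> rank_of \<I> A + rank_of \<I> B"
proof -
  obtain I where I: "I \<in> \<I>" "I \<subseteq> A \<inter> B" "card I = rank_of \<I> (A \<inter> B)"
    using rank_attained by blast
  obtain J where J: "J \<in> \<I>" "I \<subseteq> J" "J \<subseteq> A \<union> B" "card J = rank_of \<I> (A \<union> B)"
    using extend_indep[of I "A \<union> B"] I by blast
  have fin: "finite J" using J finite_indep_set by blast
  have "card J + card I \<le> card J + card (J \<inter> A \<inter> B)"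
    using I(2) J(2) fin by (intro add_left_mono card_mono) auto
  also have "\<dots> = card (J \<inter> A) + card (J \<inter> B)"
  proof -
    have "J \<inter> A \<union> J \<inter> B = J" "J \<inter> A \<inter> (J \<inter> B) = J \<inter> A \<inter> B" using J by auto
    then show ?thesis using card_Un_Int[of "J \<inter> A" "J \<inter> B"] fin by simp
  qed
  also have "\<dots> \<le> rank_of \<I> A + rank_of \<I> B"
    using J by (intro add_mono card_le_rank) (auto intro: indep_subset)
  finally show ?thesis using I J by simp
qed

lemma rank_le_add_card_diff:
  assumes "X \<subseteq> E"
  shows "rank_of \<I> X \<le> rank_of \<I> K + card (X - K)"
proof -
  have "rank_of \<I> X \<le> rank_of \<I> (K \<union> (X - K))" by (rule rank_mono) auto
  also have "\<dots> \<le> rank_of \<I> K + rank_of \<I> (X - K)"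
    using rank_submodular[of K "X - K"] by linarith
  also have "\<dots> \<le> rank_of \<I> K + card (X - K)"
    using rank_le_card finite_subset[OF assms finite_ground] by auto
  finally show ?thesis .
qed

section \<open>Circuits and unions of circuits\<close>

lemma circuit_in_insert:
  assumes "I \<in> \<I>" "insert e I \<notin> \<I>" "e \<in> E"
  obtains C where "C \<in> circuits E \<I>" "e \<in> C" "C \<subseteq> insert e I"
proof -
  let ?S = "{D. D \<subseteq> insert e I \<and> D \<notin> \<I>}"
  have "finite ?S" "?S \<noteq> {}" using assms finite_indep_set by auto
  then obtain C where C: "C \<in> ?S" "\<And>D. D \<in> ?S \<Longrightarrow> D \<subseteq> C \<Longrightarrow> D = C"
    by (metis (no_types, lifting) finite_has_minimal)
  have "C \<in> circuits E \<I>"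
    using C assms indep_subset_ground[of I] unfolding circuits_def by blast
  moreover have "e \<in> C"
    using C(1) assms(1) indep_subset[of I C] by auto
  ultimately show ?thesis using that C by auto
qed

text \<open>If deleting \<open>e\<close> keeps the rank, adding \<open>e\<close> to a basis of
  \<open>X\<close> that avoids it creates a circuit. Conversely, extend \<open>C - {e}\<close> to a
  basis of \<open>X - {e}\<close> and then to one of \<open>X\<close>; the result cannot contain
  \<open>e\<close>, as it would contain \<open>C\<close>.\<close>

lemma rank_delete_iff_circuit:
  assumes "X \<subseteq> E" "e \<in> X"
  shows "rank_of \<I> (X - {e}) = rank_of \<I> X \<longleftrightarrow> (\<exists>C\<in>circuits E \<I>. e \<in> C \<and> C \<subseteq> X)"
proof
  assume eq: "rank_of \<I> (X - {e}) = rank_of \<I> X"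
  obtain I where I: "I \<in> \<I>" "I \<subseteq> X - {e}" "card I = rank_of \<I> X"
    using rank_attained eq by metis
  have "card (insert e I) = Suc (card I)" using I finite_indep_set by (intro card_insert_disjoint) auto
  then have "insert e I \<notin> \<I>" using card_le_rank[of "insert e I" X] I assms by auto
  then obtain C where "C \<in> circuits E \<I>" "e \<in> C" "C \<subseteq> insert e I"
    using circuit_in_insert I assms by (metis subsetD)
  then show "\<exists>C\<in>circuits E \<I>. e \<in> C \<and> C \<subseteq> X" using I assms by blast
next
  assume "\<exists>C\<in>circuits E \<I>. e \<in> C \<and> C \<subseteq> X"
  then obtain C where C: "C \<in> circuits E \<I>" "e \<in> C" "C \<subseteq> X" by blast
  then have "C - {e} \<in> \<I>" unfolding circuits_def by blast
  then obtain I where I: "I \<in> \<I>" "C - {e} \<subseteq> I" "I \<subseteq> X - {e}" "card I = rank_of \<I> (X - {e})"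
    using extend_indep[of "C - {e}" "X - {e}"] C by blast
  obtain J where J: "J \<in> \<I>" "I \<subseteq> J" "J \<subseteq> X" "card J = rank_of \<I> X"
    using extend_indep[of I X] I by blast
  have "e \<notin> J"
    using C I J indep_subset[of J C] unfolding circuits_def by blast
  then have "card J \<le> rank_of \<I> (X - {e})" using J by (intro card_le_rank) auto
  then show "rank_of \<I> (X - {e}) = rank_of \<I> X"
    using J rank_mono[of "X - {e}" X] by fastforce
qed

text \<open>Turns cyclicity into a condition on ranks alone, so that it can be carried to another
  matroid by comparing rank functions.\<close>

lemma union_circuits_iff:
  assumes "X \<subseteq> E"
  shows "(\<exists>\<C>\<subseteq>circuits E \<I>. X = \<Union>\<C>) \<longleftrightarrow> (\<forall>e\<in>X. rank_of \<I> (X - {e}) = rank_of \<I> X)"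
proof
  assume "\<exists>\<C>\<subseteq>circuits E \<I>. X = \<Union>\<C>"
  then show "\<forall>e\<in>X. rank_of \<I> (X - {e}) = rank_of \<I> X"
    using rank_delete_iff_circuit[OF assms] by blast
next
  assume "\<forall>e\<in>X. rank_of \<I> (X - {e}) = rank_of \<I> X"
  then have "\<exists>C\<in>circuits E \<I>. e \<in> C \<and> C \<subseteq> X" if "e \<in> X" for e
    using that rank_delete_iff_circuit[OF assms that] by simp
  then have "X = \<Union>{C \<in> circuits E \<I>. C \<subseteq> X}" by blast
  then show "\<exists>\<C>\<subseteq>circuits E \<I>. X = \<Union>\<C>"
    by (intro exI[of _ "{C \<in> circuits E \<I>. C \<subseteq> X}"] conjI) (blast, assumption)
qed

lemma cyclic_flats_iff:
  "F \<in> cyclic_flats E \<I> \<longleftrightarrow>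
    F \<in> flats E \<I> \<and> (\<forall>e\<in>F. rank_of \<I> (F - {e}) = rank_of \<I> F)"
proof (cases "F \<in> flats E \<I>")
  case True
  then have "F \<subseteq> E" unfolding flats_def by simp
  then show ?thesis using True union_circuits_iff unfolding cyclic_flats_def by simp
qed (simp add: cyclic_flats_def)

lemma cyclic_flat_subset_ground: "F \<in> cyclic_flats E \<I> \<Longrightarrow> F \<subseteq> E"
  unfolding cyclic_flats_def flats_def by auto

lemma finite_cyclic_flats: "finite (cyclic_flats E \<I>)"
  using cyclic_flat_subset_ground finite_ground by (auto intro: finite_subset[of _ "Pow E"])

section \<open>Closure and joins of cyclic flats\<close>

definition matroid_closure :: "'a set \<Rightarrow> 'a set" where
  "matroid_closure X = {e \<in> E. rank_of \<I> (insert e X) = rank_of \<I> X}"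

lemma subset_matroid_closure: "X \<subseteq> E \<Longrightarrow> X \<subseteq> matroid_closure X"
  unfolding matroid_closure_def by (auto simp: insert_absorb)

text \<open>A basis of \<open>X\<close> cannot be extended inside the closure, since a further
  element would raise the rank of \<open>X\<close> when added to it.\<close>

lemma rank_matroid_closure:
  assumes "X \<subseteq> E"
  shows "rank_of \<I> (matroid_closure X) = rank_of \<I> X"
proof (rule antisym)
  obtain I where I: "I \<in> \<I>" "I \<subseteq> X" "card I = rank_of \<I> X" using rank_attained by blast
  obtain J where J: "J \<in> \<I>" "I \<subseteq> J" "J \<subseteq> matroid_closure X" "card J = rank_of \<I> (matroid_closure X)"
    using extend_indep[of I "matroid_closure X"] I subset_matroid_closure[OF assms] by blast
  have "J \<subseteq> I"
  proof
    fix e assume e: "e \<in> J"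
    show "e \<in> I"
    proof (rule ccontr)
      assume "e \<notin> I"
      then have "card (insert e I) = Suc (card I)" using I finite_indep_set by simp
      moreover have "insert e I \<in> \<I>" using J e indep_subset by blast
      then have "card (insert e I) \<le> rank_of \<I> (insert e X)" using I by (intro card_le_rank) auto
      ultimately show False using e J I unfolding matroid_closure_def by auto
    qed
  qed
  then show "rank_of \<I> (matroid_closure X) \<le> rank_of \<I> X"
    using I J by (metis subset_antisym order_refl)
qed (rule rank_mono[OF subset_matroid_closure[OF assms]])

lemma matroid_closure_flat:
  assumes "X \<subseteq> E"
  shows "matroid_closure X \<in> flats E \<I>"
proof -
  have "rank_of \<I> (matroid_closure X) < rank_of \<I> (insert e (matroid_closure X))"
    if "e \<in> E - matroid_closure X" for e
  proof -
    have "rank_of \<I> X < rank_of \<I> (insert e X)"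
      using that rank_mono[of X "insert e X"] unfolding matroid_closure_def by fastforce
    also have "\<dots> \<le> rank_of \<I> (insert e (matroid_closure X))"
      using subset_matroid_closure[OF assms] by (intro rank_mono) auto
    finally show ?thesis using rank_matroid_closure[OF assms] by simp
  qed
  then show ?thesis unfolding flats_def matroid_closure_def by blast
qed

text \<open>By submodularity, adding \<open>e\<close> to \<open>G\<close> raises the rank by no more
  than adding it to \<open>X\<close> does, that is, not at all.\<close>

lemma matroid_closure_least:
  assumes "X \<subseteq> G" "G \<in> flats E \<I>"
  shows "matroid_closure X \<subseteq> G"
proof
  fix e assume e: "e \<in> matroid_closure X"
  show "e \<in> G"
  proof (rule ccontr)
    assume "e \<notin> G"
    have "rank_of \<I> (insert e X \<union> G) + rank_of \<I> (insert e X \<inter> G) \<le> rank_of \<I> (insert e X) + rank_of \<I> G"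
      by (rule rank_submodular)
    moreover have "insert e X \<union> G = insert e G" "insert e X \<inter> G = X" using assms \<open>e \<notin> G\<close> by auto
    ultimately have "rank_of \<I> (insert e G) \<le> rank_of \<I> G"
      using e unfolding matroid_closure_def by simp
    moreover have "rank_of \<I> G < rank_of \<I> (insert e G)"
      using assms(2) e \<open>e \<notin> G\<close> unfolding flats_def matroid_closure_def by simp
    ultimately show False by simp
  qed
qed

text \<open>The closure has the same rank as the union, and the union keeps this rank when
  \<open>e\<close> is deleted.\<close>

lemma matroid_closure_cyclic:
  assumes "\<C> \<subseteq> circuits E \<I>"
  shows "matroid_closure (\<Union>\<C>) \<in> cyclic_flats E \<I>"
proof -
  let ?X = "\<Union>\<C>"
  have X: "?X \<subseteq> E" using assms unfolding circuits_def by auto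
  have "rank_of \<I> (matroid_closure ?X - {e}) = rank_of \<I> (matroid_closure ?X)" for e
  proof (rule antisym)
    have "rank_of \<I> ?X \<le> rank_of \<I> (?X - {e})"
    proof (cases "e \<in> ?X")
      case True
      have "\<exists>\<C>'\<subseteq>circuits E \<I>. ?X = \<Union>\<C>'" using assms by blast
      then show ?thesis using True union_circuits_iff[OF X] by (metis order_refl)
    qed simp
    also have "\<dots> \<le> rank_of \<I> (matroid_closure ?X - {e})"
      using subset_matroid_closure[OF X] by (intro rank_mono) auto
    finally show "rank_of \<I> (matroid_closure ?X) \<le> rank_of \<I> (matroid_closure ?X - {e})"
      using rank_matroid_closure[OF X] by simp
  qed (auto intro: rank_mono)
  then show ?thesis using cyclic_flats_iff matroid_closure_flat[OF X] by blast
qed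

text \<open>This closure is the join of \<open>F\<close> and \<open>G\<close> in the lattice of
  cyclic flats.\<close>

lemma matroid_closure_Un_cyclic_flat:
  assumes "F \<in> cyclic_flats E \<I>" "G \<in> cyclic_flats E \<I>"
  shows "matroid_closure (F \<union> G) \<in> cyclic_flats E \<I>"
proof -
  obtain \<A> \<B> where "\<A> \<subseteq> circuits E \<I>" "F = \<Union>\<A>" "\<B> \<subseteq> circuits E \<I>" "G = \<Union>\<B>"
    using assms unfolding cyclic_flats_def by blast
  then show ?thesis using matroid_closure_cyclic[of "\<A> \<union> \<B>"] by simp
qed

text \<open>The witness is the closure of the union of all circuits inside \<open>X\<close>.
  Together with \<open>rank_le_add_card_diff\<close>, the rank of \<open>X\<close> becomes the
  minimum of \<open>rank_of \<I> K + card (X - K)\<close> over the cyclic flats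
  \<open>K\<close>.\<close>

lemma cyclic_flat_rank_le:
  assumes "X \<subseteq> E"
  obtains K where "K \<in> cyclic_flats E \<I>" "rank_of \<I> K + card (X - K) \<le> rank_of \<I> X"
proof -
  let ?\<C> = "{C \<in> circuits E \<I>. C \<subseteq> X}"
  let ?U = "\<Union>?\<C>"
  let ?K = "matroid_closure ?U"
  have U: "?U \<subseteq> X" by auto
  obtain J where J: "J \<in> \<I>" "J \<subseteq> ?U" "card J = rank_of \<I> ?U" using rank_attained by blast
  obtain I where I: "I \<in> \<I>" "J \<subseteq> I" "I \<subseteq> X" "card I = rank_of \<I> X"
    using extend_indep[of J X] J U by blast
  \<comment> \<open>An element of \<open>X\<close> on no circuit inside \<open>X\<close> is a coloop
    of the restriction to \<open>X\<close>, so the basis \<open>I\<close> must contain it.\<close>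
  have sub: "X - ?U \<subseteq> I"
  proof
    fix e assume e: "e \<in> X - ?U"
    show "e \<in> I"
    proof (rule ccontr)
      assume "e \<notin> I"
      then have "rank_of \<I> X \<le> rank_of \<I> (X - {e})"
        using I card_le_rank[of I "X - {e}"] by auto
      then have "rank_of \<I> (X - {e}) = rank_of \<I> X"
        using rank_mono[of "X - {e}" X] by auto
      then show False using rank_delete_iff_circuit[OF assms, of e] e by blast
    qed
  qed
  have finX: "finite X" using finite_subset[OF assms finite_ground] .
  have UE: "?U \<subseteq> E" using U assms by (rule subset_trans)
  have "card (X - ?K) \<le> card (X - ?U)"
    using finX Diff_mono[OF order_refl subset_matroid_closure[OF UE]] by (intro card_mono) simp_all
  then have "rank_of \<I> ?K + card (X - ?K) \<le> card J + card (X - ?U)"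
    using rank_matroid_closure[OF UE] J(3) by linarith
  also have "\<dots> = card (J \<union> (X - ?U))"
    using J(2) finX finite_indep_set[OF J(1)] by (intro card_Un_disjoint[symmetric]) blast+
  also have "\<dots> \<le> card I"
    using I(2) sub finite_indep_set[OF I(1)] by (intro card_mono Un_least)
  also have "\<dots> = rank_of \<I> X" by (rule I(4))
  finally show ?thesis
    using matroid_closure_cyclic[of ?\<C>] that by blast
qed

text \<open>The witness is the set of loops, the closure of the empty union of circuits.\<close>

lemma cyclic_flats_least:
  obtains K where "K \<in> cyclic_flats E \<I>" "rank_of \<I> K = 0" "\<And>F. F \<in> cyclic_flats E \<I> \<Longrightarrow> K \<subseteq> F"
proof
  show "matroid_closure {} \<in> cyclic_flats E \<I>" using matroid_closure_cyclic[of "{}"] by simp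
  show "rank_of \<I> (matroid_closure {}) = 0" using rank_matroid_closure[of "{}"] rank_le_card[of "{}"] by simp
  show "matroid_closure {} \<subseteq> F" if "F \<in> cyclic_flats E \<I>" for F
    using that matroid_closure_least[of "{}" F] unfolding cyclic_flats_def by simp
qed

lemma cyclic_flats_greatest:
  obtains K where "K \<in> cyclic_flats E \<I>" "\<And>F. F \<in> cyclic_flats E \<I> \<Longrightarrow> F \<subseteq> K"
proof
  let ?K = "matroid_closure (\<Union>(circuits E \<I>))"
  show "?K \<in> cyclic_flats E \<I>" by (rule matroid_closure_cyclic) simp
  have "\<Union>(circuits E \<I>) \<subseteq> E" unfolding circuits_def by auto
  then show "F \<subseteq> ?K" if "F \<in> cyclic_flats E \<I>" for F
    using that subset_matroid_closure unfolding cyclic_flats_def by blast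
qed

text \<open>For the converse, the cyclic flat \<open>K\<close> of \<open>cyclic_flat_rank_le\<close>
  splits \<open>X\<close> into \<open>X \<inter> K\<close>, of size at most the rank of
  \<open>K\<close>, and \<open>X - K\<close>; hence \<open>card X\<close> is at most the rank of
  \<open>X\<close>.\<close>

lemma indep_iff_cyclic_flats:
  "X \<in> \<I> \<longleftrightarrow> X \<subseteq> E \<and> (\<forall>F\<in>cyclic_flats E \<I>. card (X \<inter> F) \<le> rank_of \<I> F)"
proof
  assume "X \<in> \<I>"
  then show "X \<subseteq> E \<and> (\<forall>F\<in>cyclic_flats E \<I>. card (X \<inter> F) \<le> rank_of \<I> F)"
    using indep_subset_ground[of X] indep_subset[of X "X \<inter> F" for F] card_le_rank[of "X \<inter> F" F for F] by simp
next
  assume X: "X \<subseteq> E \<and> (\<forall>F\<in>cyclic_flats E \<I>. card (X \<inter> F) \<le> rank_of \<I> F)"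
  then have fin: "finite X" using finite_ground finite_subset by blast
  obtain K where K: "K \<in> cyclic_flats E \<I>" "rank_of \<I> K + card (X - K) \<le> rank_of \<I> X"
    using cyclic_flat_rank_le X by blast
  have "card X = card (X \<inter> K) + card (X - K)"
    using fin by (metis card_Int_Diff)
  moreover have "card (X \<inter> K) \<le> rank_of \<I> K" using X K(1) by blast
  ultimately show "X \<in> \<I>" using indep_iff_rank[OF fin] K(2) by simp
qed

lemma bases_iff: "B \<in> bases \<I> \<longleftrightarrow> B \<in> \<I> \<and> card B = rank_of \<I> E"
proof
  assume B: "B \<in> bases \<I>"
  then have "B \<in> \<I>" unfolding bases_def by auto
  then obtain Z where "Z \<in> \<I>" "B \<subseteq> Z" "card Z = rank_of \<I> E"
    using extend_indep[OF _ indep_subset_ground] by metis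
  then show "B \<in> \<I> \<and> card B = rank_of \<I> E" using B unfolding bases_def by auto
next
  assume B: "B \<in> \<I> \<and> card B = rank_of \<I> E"
  then have "X = B" if "X \<in> \<I>" "B \<subseteq> X" for X
    using that card_le_rank[of X E] indep_subset_ground finite_indep_set[of X] card_seteq[of X B] by auto
  then show "B \<in> bases \<I>" using B unfolding bases_def by auto
qed

end

text \<open>Provides the uniqueness behind the definite description in
  \<open>schubert\<close>.\<close>

lemma matroid_eqI_cyclic_flats:
  assumes "matroid E \<I>" "matroid E \<J>"
    and "cyclic_flats E \<I> = cyclic_flats E \<J>"
    and "\<And>F. F \<in> cyclic_flats E \<J> \<Longrightarrow> rank_of \<I> F = rank_of \<J> F"
  shows "\<I> = \<J>"
  using matroid.indep_iff_cyclic_flats[OF assms(1)] matroid.indep_iff_cyclic_flats[OF assms(2)]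
    assms(3,4) by (intro set_eqI) simp

section \<open>Schubert matroids\<close>

context matroid
begin

context
  fixes C :: "'a set set"
  assumes C: "C \<in> bounded_chains (cyclic_flats E \<I>)"
begin

text \<open>The criterion \<open>indep_iff_cyclic_flats\<close> imposed along the chain only: an
  explicit model of \<open>schubert E \<I> C\<close>.\<close>

definition nested :: "'a set set" where
  "nested = {I. I \<subseteq> E \<and> (\<forall>F\<in>C. card (I \<inter> F) \<le> rank_of \<I> F)}"

lemma bounded_chain_subset: "C \<subseteq> cyclic_flats E \<I>"
  and bounded_chain_linear: "F \<in> C \<Longrightarrow> G \<in> C \<Longrightarrow> F \<subseteq> G \<or> G \<subseteq> F"
  using C unfolding bounded_chains_def pred_on.chain_def by auto

lemma finite_bounded_chain: "finite C"
  using bounded_chain_subset finite_cyclic_flats finite_subset by blast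

lemma bounded_chain_greatest:
  assumes "P F" "F \<in> C"
  obtains T where "T \<in> C" "P T" "\<And>F. F \<in> C \<Longrightarrow> P F \<Longrightarrow> F \<subseteq> T"
proof -
  have "finite {F \<in> C. P F}" "{F \<in> C. P F} \<noteq> {}" using finite_bounded_chain assms by auto
  then obtain T where "T \<in> {F \<in> C. P F}" "\<And>F. F \<in> {F \<in> C. P F} \<Longrightarrow> T \<subseteq> F \<Longrightarrow> F = T"
    by (metis (no_types, lifting) finite_has_maximal)
  then show ?thesis using that[of T] bounded_chain_linear[of _ T] by blast
qed

lemma bounded_chain_rank_0: obtains K where "K \<in> C" "rank_of \<I> K = 0"
proof -
  obtain L where L: "L \<in> cyclic_flats E \<I>" "rank_of \<I> L = 0" by (rule cyclic_flats_least)
  obtain K where K: "K \<in> C" "\<And>F. F \<in> cyclic_flats E \<I> \<Longrightarrow> K \<subseteq> F"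
    using C unfolding bounded_chains_def by auto
  have "rank_of \<I> K = 0" using rank_mono[OF K(2)[OF L(1)]] L(2) by simp
  then show ?thesis using that K by blast
qed

text \<open>Call a member \<open>F\<close> tight for \<open>X\<close> if
  \<open>card (X \<inter> F)\<close> equals its rank. For augmentation take the largest tight member
  \<open>T\<close>: the surplus of \<open>Y\<close> over \<open>X\<close> must show outside
  \<open>T\<close>, and an element \<open>y\<close> there lies in no tight member, since these are
  all inside \<open>T\<close>.\<close>

lemma matroid_nested: "matroid E nested"
proof
  show "\<exists>y\<in>Y - X. insert y X \<in> nested"
    if X: "X \<in> nested" and Y: "Y \<in> nested" and less: "card X < card Y" for X Y
  proof -
    have fin: "finite X" "finite Y" using X Y finite_ground finite_subset unfolding nested_def by auto
    \<comment> \<open>A member that is not tight has room for one more element.\<close>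
    have ins: "card (insert y X \<inter> F) \<le> rank_of \<I> F"
      if "F \<in> C" "card (X \<inter> F) \<noteq> rank_of \<I> F" for F y
    proof -
      have "card (insert y X \<inter> F) \<le> card (insert y (X \<inter> F))" using fin by (intro card_mono) auto
      also have "\<dots> \<le> Suc (card (X \<inter> F))" by (rule card_insert_le_m1) auto
      also have "Suc (card (X \<inter> F)) \<le> rank_of \<I> F" using that X unfolding nested_def by (simp add: Suc_le_eq le_neq_implies_less)
      finally show ?thesis .
    qed
    show ?thesis
    proof (cases "\<exists>F\<in>C. card (X \<inter> F) = rank_of \<I> F")
      case True
      then obtain T where T: "T \<in> C" "card (X \<inter> T) = rank_of \<I> T"
        and max: "\<And>F. F \<in> C \<Longrightarrow> card (X \<inter> F) = rank_of \<I> F \<Longrightarrow> F \<subseteq> T"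
        using bounded_chain_greatest[of "\<lambda>F. card (X \<inter> F) = rank_of \<I> F"] by metis
      have "card (Y \<inter> T) \<le> card (X \<inter> T)" using Y T unfolding nested_def by auto
      moreover have "card X = card (X \<inter> T) + card (X - T)" "card Y = card (Y \<inter> T) + card (Y - T)"
        using fin card_Int_Diff by metis+
      ultimately have "card (X - T) < card (Y - T)" using less by simp
      then have "\<not> Y - T \<subseteq> X - T" using fin card_mono[of "X - T" "Y - T"] by auto
      then obtain y where y: "y \<in> Y" "y \<notin> T" "y \<notin> X" by auto
      have "card (insert y X \<inter> F) \<le> rank_of \<I> F" if F: "F \<in> C" for F
      proof (cases "card (X \<inter> F) = rank_of \<I> F")
        case True
        then have "insert y X \<inter> F = X \<inter> F" using max F y by auto
        then show ?thesis using True by simp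
      qed (use ins F in auto)
      then have "insert y X \<in> nested" using X Y y unfolding nested_def by auto
      then show ?thesis using y by blast
    next
      case False
      have "\<not> Y \<subseteq> X" using less fin card_mono[of X Y] by auto
      then obtain y where y: "y \<in> Y" "y \<notin> X" by auto
      then have "insert y X \<in> nested" using False ins X Y unfolding nested_def by auto
      then show ?thesis using y by blast
    qed
  qed
  show "Y \<in> nested" if "X \<in> nested" "Y \<subseteq> X" for X Y
  proof -
    have fin: "finite X" using that finite_ground finite_subset unfolding nested_def by auto
    have "card (Y \<inter> F) \<le> card (X \<inter> F)" for F using that fin by (intro card_mono) auto
    then show ?thesis using that order_trans unfolding nested_def by blast
  qed
qed (auto simp: nested_def finite_ground)

interpretation N: matroid E nested by (rule matroid_nested)

lemma indep_nested: "\<I> \<subseteq> nested"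
  using indep_iff_cyclic_flats bounded_chain_subset unfolding nested_def by blast

lemma rank_le_rank_nested: "rank_of \<I> X \<le> rank_of nested X"
  using indep_nested by (intro rank_leI N.card_le_rank) auto

lemma rank_nested:
  assumes "F \<in> C"
  shows "rank_of nested F = rank_of \<I> F"
proof (rule antisym)
  show "rank_of nested F \<le> rank_of \<I> F"
  proof (rule N.rank_leI)
    fix Y assume "Y \<in> nested" "Y \<subseteq> F"
    then show "card Y \<le> rank_of \<I> F" using assms unfolding nested_def by (metis (no_types, lifting) inf.orderE mem_Collect_eq)
  qed
qed (rule rank_le_rank_nested)

text \<open>The chain contains the greatest cyclic flat \<open>K\<close>, and \<open>L\<close>
  attains the rank of \<open>E\<close>. As \<open>L \<subseteq> K\<close>, the sets
  \<open>K - L\<close> and \<open>E - K\<close> partition \<open>E - L\<close>, which bounds the new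
  rank by that of \<open>E\<close>.\<close>

lemma rank_nested_ground: "rank_of nested E = rank_of \<I> E"
proof (rule antisym)
  obtain K where K: "K \<in> C" "\<And>F. F \<in> cyclic_flats E \<I> \<Longrightarrow> F \<subseteq> K"
    using C unfolding bounded_chains_def by auto
  then have KE: "K \<subseteq> E" using bounded_chain_subset cyclic_flat_subset_ground by blast
  obtain L where L: "L \<in> cyclic_flats E \<I>" "rank_of \<I> L + card (E - L) \<le> rank_of \<I> E"
    using cyclic_flat_rank_le by blast
  have "rank_of nested E \<le> rank_of nested K + card (E - K)" by (rule N.rank_le_add_card_diff) simp
  also have "\<dots> = rank_of \<I> K + card (E - K)" using rank_nested K by simp
  also have "\<dots> \<le> rank_of \<I> L + card (K - L) + card (E - K)" using rank_le_add_card_diff[OF KE] by simp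
  also have "\<dots> = rank_of \<I> L + card ((K - L) \<union> (E - K))"
    using finite_ground KE finite_subset by (subst card_Un_disjoint) auto
  also have "(K - L) \<union> (E - K) = E - L" using KE K(2)[OF L(1)] by auto
  finally show "rank_of nested E \<le> rank_of \<I> E" using L by simp
qed (rule rank_le_rank_nested)

text \<open>On members of \<open>C\<close> the two ranks agree and elsewhere the new one is at least
  the old one, so members remain flat and cyclic. Conversely, a cyclic flat \<open>G\<close> of
  \<open>nested\<close> with basis \<open>I\<close> equals the largest member \<open>T\<close> of
  \<open>C\<close> that is tight for \<open>I\<close>.\<close>

lemma cyclic_flats_nested: "cyclic_flats E nested = C"
proof (intro equalityI subsetI)
  fix F assume F: "F \<in> C"
  then have Z: "F \<in> cyclic_flats E \<I>" using bounded_chain_subset by auto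
  have "rank_of nested F < rank_of nested (insert e F)" if "e \<in> E - F" for e
  proof -
    have "rank_of \<I> F < rank_of \<I> (insert e F)"
      using that Z unfolding cyclic_flats_def flats_def by auto
    then show ?thesis using rank_nested[OF F] rank_le_rank_nested[of "insert e F"] by simp
  qed
  moreover have "rank_of nested (F - {e}) = rank_of nested F" if "e \<in> F" for e
  proof -
    have "rank_of \<I> (F - {e}) = rank_of \<I> F" using that Z cyclic_flats_iff by blast
    then show ?thesis
      using rank_nested[OF F] rank_le_rank_nested[of "F - {e}"] N.rank_mono[of "F - {e}" F] by auto
  qed
  ultimately show "F \<in> cyclic_flats E nested"
    using N.cyclic_flats_iff Z cyclic_flat_subset_ground unfolding flats_def by auto
next
  fix G assume "G \<in> cyclic_flats E nested"
  then have flat: "\<And>e. e \<in> E - G \<Longrightarrow> rank_of nested G < rank_of nested (insert e G)"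
    and cyc: "\<And>e. e \<in> G \<Longrightarrow> rank_of nested (G - {e}) = rank_of nested G" and GE: "G \<subseteq> E"
    using N.cyclic_flats_iff unfolding flats_def by auto
  obtain I where I: "I \<in> nested" "I \<subseteq> G" "card I = rank_of nested G" using N.rank_attained by blast
  have fin: "finite I" using I(1) N.finite_indep_set by blast
  \<comment> \<open>A member of rank 0 is tight for \<open>I\<close>, so tight members
    exist.\<close>
  obtain K where K: "K \<in> C" "card (I \<inter> K) = rank_of \<I> K"
  proof -
    obtain K where "K \<in> C" "rank_of \<I> K = 0" by (rule bounded_chain_rank_0)
    then show thesis using that[of K] I(1) unfolding nested_def by force
  qed
  obtain T where T: "T \<in> C" "card (I \<inter> T) = rank_of \<I> T"
    and max: "\<And>F. F \<in> C \<Longrightarrow> card (I \<inter> F) = rank_of \<I> F \<Longrightarrow> F \<subseteq> T"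
    using bounded_chain_greatest[of "\<lambda>F. card (I \<inter> F) = rank_of \<I> F", OF K(2,1)] by metis
  \<comment> \<open>Adding \<open>e\<close> to \<open>I\<close> violates the constraint of some
    member, which must be tight for \<open>I\<close> and contain \<open>e\<close>; it lies inside
    \<open>T\<close>.\<close>
  have sub: "G - I \<subseteq> T"
  proof
    fix e assume e: "e \<in> G - I"
    have "insert e I \<notin> nested"
      using e fin I N.card_le_rank[of "insert e I" G] by auto
    then obtain F where F: "F \<in> C" "rank_of \<I> F < card (insert e I \<inter> F)"
      using e I GE unfolding nested_def by auto
    have le: "card (I \<inter> F) \<le> rank_of \<I> F" using I F unfolding nested_def by auto
    then have "e \<in> F" using F by (cases "e \<in> F") auto
    then have "card (insert e I \<inter> F) = Suc (card (I \<inter> F))" using e fin by simp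
    then have "card (I \<inter> F) = rank_of \<I> F" using le F by simp
    then show "e \<in> T" using max F \<open>e \<in> F\<close> by blast
  qed
  have split: "card I = card (I \<inter> T) + card (I - T)" using fin card_Int_Diff by metis
  \<comment> \<open>An element of \<open>I\<close> outside \<open>T\<close> would be a coloop of
    \<open>G\<close>: deleting it lowers the bound \<open>rank T + card (I - T)\<close>, which
    equals \<open>card I\<close>.\<close>
  have "G \<subseteq> T"
  proof
    fix e assume e: "e \<in> G"
    show "e \<in> T"
    proof (rule ccontr)
      assume nT: "e \<notin> T"
      then have "e \<in> I" using sub e by auto
      have "rank_of nested (G - {e}) \<le> rank_of nested T + card (G - {e} - T)"
        using GE by (intro N.rank_le_add_card_diff) auto
      also have "G - {e} - T = I - T - {e}" using sub I by auto
      also have "rank_of nested T + card (I - T - {e}) < card I"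
        using split T rank_nested[OF T(1)] fin \<open>e \<in> I\<close> nT card_Diff1_less[of "I - T" e] by simp
      finally show False using cyc[OF e] I by simp
    qed
  qed
  \<comment> \<open>The rank of \<open>T\<close> is at most \<open>card I\<close>, the rank of
    \<open>G\<close>, so the flat \<open>G\<close> leaves out no element of
    \<open>T\<close>.\<close>
  moreover have "T \<subseteq> G"
  proof
    fix e assume e: "e \<in> T"
    show "e \<in> G"
    proof (rule ccontr)
      assume "e \<notin> G"
      moreover have "T \<subseteq> E" using T bounded_chain_subset cyclic_flat_subset_ground by blast
      ultimately have "rank_of nested G < rank_of nested (insert e G)" using flat e by auto
      also have "\<dots> \<le> rank_of nested T" using \<open>G \<subseteq> T\<close> e by (intro N.rank_mono) auto
      also have "\<dots> \<le> card I" using split T rank_nested by simp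
      finally show False using I by simp
    qed
  qed
  ultimately show "G \<in> C" using T by auto
qed

lemma schubert_eq_nested: "schubert E \<I> C = nested"
  unfolding schubert_def
proof (rule the_equality)
  show "matroid E nested \<and> cyclic_flats E nested = C \<and> (\<forall>F\<in>C. rank_of nested F = rank_of \<I> F)"
    using matroid_nested cyclic_flats_nested rank_nested by blast
  show "\<J> = nested"
    if \<J>: "matroid E \<J> \<and> cyclic_flats E \<J> = C \<and> (\<forall>F\<in>C. rank_of \<J> F = rank_of \<I> F)" for \<J>
  proof (rule matroid_eqI_cyclic_flats[OF _ matroid_nested])
    show "rank_of \<J> F = rank_of nested F" if "F \<in> cyclic_flats E nested" for F
      using that \<J> rank_nested cyclic_flats_nested by simp
  qed (use \<J> cyclic_flats_nested in simp_all)
qed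

lemmas matroid_schubert = matroid_nested[folded schubert_eq_nested]
  and cyclic_flats_schubert = cyclic_flats_nested[folded schubert_eq_nested]
  and rank_schubert = rank_nested[folded schubert_eq_nested]
  and rank_schubert_ground = rank_nested_ground[folded schubert_eq_nested]

end

end

section \<open>Sums of Moebius values over chains\<close>

lemma mobius_same: "finite P \<Longrightarrow> x \<in> P \<Longrightarrow> mobius P x x = 1"
  by (subst mobius.simps) simp

lemma sum_mobius_lower:
  assumes "finite P" "x \<in> P" "y \<in> P" "x \<le> y"
  shows "(\<Sum>z | z \<in> P \<and> x \<le> z \<and> z \<le> y. mobius P x z) = (if x = y then 1 else 0)"
proof (cases "x = y")
  case True
  then have "{z. z \<in> P \<and> x \<le> z \<and> z \<le> y} = {x}" using assms by auto
  then show ?thesis using True mobius_same assms by simp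
next
  case False
  then have "{z. z \<in> P \<and> x \<le> z \<and> z \<le> y} = insert y {z. z \<in> P \<and> x \<le> z \<and> z < y}"
    using assms by auto
  then have "(\<Sum>z | z \<in> P \<and> x \<le> z \<and> z \<le> y. mobius P x z)
      = mobius P x y + (\<Sum>z | z \<in> P \<and> x \<le> z \<and> z < y. mobius P x z)"
    using assms by simp
  also have "mobius P x y = - (\<Sum>z | z \<in> P \<and> x \<le> z \<and> z < y. mobius P x z)"
    using assms False by (subst mobius.simps) simp
  finally show ?thesis using False by simp
qed

text \<open>The recursion of \<open>mobius\<close> fixes the lower argument, while the coefficients
  vary it. Sum \<open>mobius P x u * mobius P z y\<close> over all \<open>u \<le> z\<close> in the
  interval: summing over \<open>u\<close> first gives \<open>mobius P x y\<close>, summing over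
  \<open>z\<close> first gives the desired sum plus \<open>mobius P x y\<close>, by induction on the
  interval.\<close>

lemma sum_mobius_upper:
  assumes "finite P" "x \<in> P" "y \<in> P" "x \<le> y"
  shows "(\<Sum>z | z \<in> P \<and> x \<le> z \<and> z \<le> y. mobius P z y) = (if x = y then 1 else 0)"
  using assms(2,4)
proof (induction "card {z. z \<in> P \<and> x \<le> z \<and> z \<le> y}" arbitrary: x rule: less_induct)
  case less
  define I where "I = (\<lambda>x y. {z. z \<in> P \<and> x \<le> z \<and> z \<le> y})"
  have finI: "finite (I u v)" for u v using assms(1) unfolding I_def by simp
  show ?case
  proof (cases "x = y")
    case True
    then have "{z. z \<in> P \<and> x \<le> z \<and> z \<le> y} = {x}" using less.prems by auto
    then show ?thesis using True mobius_same assms by simp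
  next
    case False
    have IH: "(\<Sum>z\<in>I u y. mobius P z y) = (if u = y then 1 else 0)"
      if u: "u \<in> I x y - {x}" for u
    proof -
      have "I u y \<subset> I x y" using u less.prems unfolding I_def by force
      then have "card (I u y) < card (I x y)" by (intro psubset_card_mono finI)
      then show ?thesis using less.hyps[of u] u unfolding I_def by simp
    qed
    have xI: "x \<in> I x y" and yI: "y \<in> I x y - {x}"
      using less.prems assms False unfolding I_def by auto
    have "mobius P x y = (\<Sum>z\<in>I x y. if z = x then mobius P z y else 0)"
      using finI xI by (simp add: sum.delta)
    also have "\<dots> = (\<Sum>z\<in>I x y. (\<Sum>u\<in>I x z. mobius P x u) * mobius P z y)"
    proof (rule sum.cong)
      fix z assume "z \<in> I x y"
      then have "(\<Sum>u\<in>I x z. mobius P x u) = (if x = z then 1 else 0)"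
        using sum_mobius_lower[OF assms(1), of x z] less.prems unfolding I_def by simp
      then show "(if z = x then mobius P z y else 0) = (\<Sum>u\<in>I x z. mobius P x u) * mobius P z y"
        by simp
    qed simp
    also have "\<dots> = (\<Sum>z\<in>I x y. \<Sum>u | u \<in> I x y \<and> u \<le> z. mobius P x u * mobius P z y)"
    proof (rule sum.cong)
      fix z assume "z \<in> I x y"
      then have "I x z = {u. u \<in> I x y \<and> u \<le> z}" unfolding I_def by auto
      then show "(\<Sum>u\<in>I x z. mobius P x u) * mobius P z y
        = (\<Sum>u | u \<in> I x y \<and> u \<le> z. mobius P x u * mobius P z y)"
        by (simp add: sum_distrib_right)
    qed simp
    also have "\<dots> = (\<Sum>u\<in>I x y. \<Sum>z | z \<in> I x y \<and> u \<le> z. mobius P x u * mobius P z y)"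
      by (rule sum.swap_restrict[OF finI finI])
    also have "\<dots> = (\<Sum>u\<in>I x y. mobius P x u * (\<Sum>z\<in>I u y. mobius P z y))"
    proof (rule sum.cong)
      fix u assume "u \<in> I x y"
      then have "I u y = {z. z \<in> I x y \<and> u \<le> z}" unfolding I_def by auto
      then show "(\<Sum>z | z \<in> I x y \<and> u \<le> z. mobius P x u * mobius P z y)
        = mobius P x u * (\<Sum>z\<in>I u y. mobius P z y)"
        by (simp add: sum_distrib_left)
    qed simp
    \<comment> \<open>The term \<open>u = x\<close> carries the desired sum; among the others the
      induction hypothesis leaves only \<open>u = y\<close>.\<close>
    also have "\<dots> = mobius P x x * (\<Sum>z\<in>I x y. mobius P z y)
        + (\<Sum>u\<in>I x y - {x}. mobius P x u * (\<Sum>z\<in>I u y. mobius P z y))"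
      by (rule sum.remove[OF finI xI])
    also have "(\<Sum>u\<in>I x y - {x}. mobius P x u * (\<Sum>z\<in>I u y. mobius P z y))
        = (\<Sum>u\<in>I x y - {x}. if u = y then mobius P x u else 0)"
      by (rule sum.cong[OF refl]) (simp add: IH)
    also have "\<dots> = mobius P x y"
      using finI yI by (simp add: sum.delta)
    finally show ?thesis
      using False mobius_same[OF assms(1) less.prems(1)] unfolding I_def by simp
  qed
qed

section \<open>Chains of a bounded poset and their Moebius coefficients\<close>

lemma chain_less_iff:
  "pred_on.chain P (<) C \<longleftrightarrow> C \<subseteq> P \<and> (\<forall>x\<in>C. \<forall>y\<in>C. x \<le> y \<or> y \<le> x)"
  for P :: "'a::order set"
  unfolding pred_on.chain_def by (auto simp: le_less)

lemma finite_bounded_chains: "finite P \<Longrightarrow> finite (bounded_chains P)"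
  unfolding bounded_chains_def pred_on.chain_def by (auto intro: finite_subset[of _ "Pow P"])

lemma finite_chain_lattice: "finite P \<Longrightarrow> finite (chain_lattice P)"
  unfolding chain_lattice_def by (simp add: finite_bounded_chains)

text \<open>The chains containing \<open>D\<close> are those above \<open>D \<union> {a, b}\<close>
  in the chain lattice. Over the interval from there to the top the Moebius values sum to 0, and the
  top itself contributes 1.\<close>

lemma sum_mobius_above_chain:
  fixes P :: "'a::order set"
  assumes "finite P" "pred_on.chain P (<) D"
    and "a \<in> P" "\<And>p. p \<in> P \<Longrightarrow> a \<le> p" "b \<in> P" "\<And>p. p \<in> P \<Longrightarrow> p \<le> b"
  shows "(\<Sum>C | C \<in> bounded_chains P \<and> D \<subseteq> C.
    - mobius (chain_lattice P) (top.Value C) top.Top) = 1"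
proof -
  let ?D = "D \<union> {a, b}"
  let ?L = "chain_lattice P"
  have D: "?D \<in> bounded_chains P"
    using assms unfolding bounded_chains_def chain_less_iff by (auto 0 3)
  have ends: "a \<in> C" "b \<in> C" if C: "C \<in> bounded_chains P" for C
  proof -
    obtain c d where "c \<in> C" "\<forall>p\<in>P. c \<le> p" "d \<in> C" "\<forall>p\<in>P. p \<le> d" "C \<subseteq> P"
      using C unfolding bounded_chains_def chain_less_iff by auto
    moreover from this have "c = a" "d = b" using assms(3-6) by (blast intro: order_antisym)+
    ultimately show "a \<in> C" "b \<in> C" by simp_all
  qed
  have "{z. z \<in> ?L \<and> top.Value ?D \<le> z \<and> z \<le> top.Top}
      = insert top.Top (top.Value ` {C. C \<in> bounded_chains P \<and> D \<subseteq> C})"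
    using ends unfolding chain_lattice_def by auto
  then have "0 = (\<Sum>z\<in>insert top.Top (top.Value ` {C. C \<in> bounded_chains P \<and> D \<subseteq> C}).
      mobius ?L z top.Top)"
    using sum_mobius_upper[OF finite_chain_lattice[OF assms(1)], of "top.Value ?D" top.Top] D
    by (simp add: chain_lattice_def)
  also have "\<dots> = mobius ?L top.Top top.Top
      + (\<Sum>C | C \<in> bounded_chains P \<and> D \<subseteq> C. mobius ?L (top.Value C) top.Top)"
    using finite_bounded_chains[OF assms(1)]
    by (subst sum.insert) (auto simp: sum.reindex inj_on_def)
  also have "mobius ?L top.Top top.Top = 1"
    using finite_chain_lattice assms(1) by (intro mobius_same) (auto simp: chain_lattice_def)
  finally show ?thesis by (simp add: sum_negf)
qed

text \<open>
  The sign-reversing involution toggles \<open>j p\<close>, where \<open>p\<close> is the largest element of the chain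
  that is not above \<open>m\<close>, or \<open>m\<close> itself when there is no such element.
\<close>

lemma alternating_sum_chains_eq_0:
  fixes V :: "'a::order set"
  assumes fin: "finite V" and m: "m \<in> V" and jV: "\<And>p. p \<in> V \<Longrightarrow> j p \<in> V"
    and pj: "\<And>p. p \<in> V \<Longrightarrow> p \<le> j p" and mj: "\<And>p. p \<in> V \<Longrightarrow> m \<le> j p"
    and least: "\<And>p q. p \<in> V \<Longrightarrow> q \<in> V \<Longrightarrow> p \<le> q \<Longrightarrow> m \<le> q \<Longrightarrow> j p \<le> q"
  shows "(\<Sum>D | pred_on.chain V (<) D. (- 1) ^ card D) = (0 :: int)"
proof -
  define N where "N = (\<lambda>D. {p \<in> D. \<not> m \<le> p})"
  define s where "s = (\<lambda>D. if N D = {} then m else j (SOME p. p \<in> N D \<and> (\<forall>q\<in>N D. q \<le> p)))"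
  define t where "t = (\<lambda>D. if s D \<in> D then D - {s D} else insert (s D) D)"
  have finD: "finite D" if "pred_on.chain V (<) D" for D
    using that fin finite_subset unfolding chain_less_iff by blast
  have s: "s D \<in> V \<and> m \<le> s D \<and> (\<forall>q\<in>D. q \<le> s D \<or> s D \<le> q)" if D: "pred_on.chain V (<) D" for D
  proof (cases "N D = {}")
    case True
    then show ?thesis using m unfolding s_def N_def by auto
  next
    case False
    define p where "p = (SOME p. p \<in> N D \<and> (\<forall>q\<in>N D. q \<le> p))"
    have "finite (N D)" using finD[OF D] unfolding N_def by simp
    then obtain p' where p': "p' \<in> N D" "\<And>q. q \<in> N D \<Longrightarrow> p' \<le> q \<Longrightarrow> q = p'"
      using False finite_has_maximal[of "N D"] by metis
    have "q \<le> p'" if "q \<in> N D" for q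
      using that p' D unfolding chain_less_iff N_def by blast
    then have "p \<in> N D \<and> (\<forall>q\<in>N D. q \<le> p)"
      unfolding p_def using p'(1) by (intro someI[of "\<lambda>p. p \<in> N D \<and> (\<forall>q\<in>N D. q \<le> p)" p']) blast
    then have p: "p \<in> D" "p \<in> V" "\<not> m \<le> p" "\<And>q. q \<in> N D \<Longrightarrow> q \<le> p"
      using D unfolding N_def chain_less_iff by auto
    have sD: "s D = j p" using False unfolding s_def p_def by simp
    \<comment> \<open>An element not above \<open>m\<close> is at most \<open>p\<close>, hence at
      most \<open>j p\<close>. An element above \<open>m\<close> cannot be below \<open>p\<close>,
      so it is above both \<open>p\<close> and \<open>m\<close> and thus above
      \<open>j p\<close>.\<close>
    have "q \<le> j p \<or> j p \<le> q" if q: "q \<in> D" for q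
    proof (cases "m \<le> q")
      case True
      then have "\<not> q \<le> p" using p(3) order_trans by blast
      then have "p \<le> q" using D p(1) q unfolding chain_less_iff by blast
      then show ?thesis using True least p q D unfolding chain_less_iff by blast
    next
      case False
      then show ?thesis using q p(4) pj[OF p(2)] order_trans unfolding N_def by blast
    qed
    then show ?thesis using sD p jV mj by auto
  qed
  \<comment> \<open>The toggled element is above \<open>m\<close>, so the part of the chain not
    above \<open>m\<close> stays the same, and with it the choice of \<open>s\<close>; this makes
    \<open>t\<close> an involution.\<close>
  have N_t: "N (t D) = N D" if "pred_on.chain V (<) D" for D
    using s[OF that] unfolding N_def t_def by auto
  then have s_t: "s (t D) = s D" if "pred_on.chain V (<) D" for D
    using that unfolding s_def by simp
  have chain_t: "pred_on.chain V (<) (t D)" if "pred_on.chain V (<) D" for D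
    using s[OF that] that unfolding t_def chain_less_iff by auto
  have t_t: "t (t D) = D" if "pred_on.chain V (<) D" for D
    using s_t[OF that] unfolding t_def by (auto split: if_splits)
  have card_t: "(- 1) ^ card (t D) = - ((- 1) ^ card D :: int)" if D: "pred_on.chain V (<) D" for D
  proof (cases "s D \<in> D")
    case True
    then have "card D = Suc (card (t D))"
      unfolding t_def using finD[OF D] card_Suc_Diff1[of D "s D"] by simp
    then show ?thesis by simp
  qed (use finD[OF D] in \<open>simp add: t_def\<close>)
  have "(\<Sum>D | pred_on.chain V (<) D. (- 1) ^ card D)
      = (\<Sum>D | pred_on.chain V (<) D. - ((- 1) ^ card D :: int))"
    by (rule sum.reindex_bij_witness[of _ t t]) (auto simp: t_t chain_t card_t)
  then show ?thesis by (simp add: sum_negf)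
qed

section \<open>Inclusion-exclusion over chains avoiding a subset\<close>

lemma alternating_sum_subsets:
  "finite A \<Longrightarrow> (\<Sum>D\<in>Pow A. (- 1) ^ card D) = (if A = {} then 1 else (0 :: int))"
  using prod_diff_conv_sum[of A "\<lambda>_. 1 :: int" "\<lambda>_. 1"] by (simp add: power_0_left)

text \<open>Replace the condition \<open>C \<inter> V = {}\<close> by the alternating sum over the
  subsets of \<open>C \<inter> V\<close>, which are the chains of \<open>V\<close> inside
  \<open>C\<close>. After exchanging the sums, the coefficients of all \<open>C\<close> containing a
  fixed \<open>D\<close> add up to 1.\<close>

lemma sum_mobius_chains_avoiding:
  fixes P :: "'a::order set"
  assumes fin: "finite P" and VP: "V \<subseteq> P"
    and ends: "a \<in> P" "\<And>p. p \<in> P \<Longrightarrow> a \<le> p" "b \<in> P" "\<And>p. p \<in> P \<Longrightarrow> p \<le> b"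
  shows "(\<Sum>C | C \<in> bounded_chains P \<and> C \<inter> V = {}.
      - mobius (chain_lattice P) (top.Value C) top.Top)
    = (\<Sum>D | pred_on.chain V (<) D. (- 1) ^ card D)"
proof -
  let ?l = "\<lambda>C. - mobius (chain_lattice P) (top.Value C) top.Top"
  let ?B = "bounded_chains P"
  let ?K = "{D. pred_on.chain V (<) D}"
  have finB: "finite ?B" using fin by (rule finite_bounded_chains)
  have finK: "finite ?K" using VP fin finite_subset[of ?K "Pow P"] unfolding chain_less_iff by auto
  have "(\<Sum>C | C \<in> ?B \<and> C \<inter> V = {}. ?l C) = (\<Sum>C\<in>?B. if C \<inter> V = {} then ?l C else 0)"
    using finB by (rule sum.inter_filter)
  also have "\<dots> = (\<Sum>C\<in>?B. \<Sum>D | D \<in> ?K \<and> D \<subseteq> C. (- 1) ^ card D * ?l C)"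
  proof (rule sum.cong)
    fix C assume C: "C \<in> ?B"
    have "\<forall>x\<in>C. \<forall>y\<in>C. x \<le> y \<or> y \<le> x"
      using C unfolding bounded_chains_def chain_less_iff by blast
    then have K: "{D. D \<in> ?K \<and> D \<subseteq> C} = Pow (C \<inter> V)"
      unfolding chain_less_iff by blast
    have "finite (C \<inter> V)" using VP fin finite_subset by blast
    then have "(if C \<inter> V = {} then ?l C else 0) = (\<Sum>D\<in>Pow (C \<inter> V). (- 1) ^ card D) * ?l C"
      by (simp only: alternating_sum_subsets) simp
    then show "(if C \<inter> V = {} then ?l C else 0)
        = (\<Sum>D | D \<in> ?K \<and> D \<subseteq> C. (- 1) ^ card D * ?l C)"
      by (simp only: K sum_distrib_right)
  qed simp
  also have "\<dots> = (\<Sum>D\<in>?K. \<Sum>C | C \<in> ?B \<and> D \<subseteq> C. (- 1) ^ card D * ?l C)"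
    using finB finK by (rule sum.swap_restrict)
  also have "\<dots> = (\<Sum>D\<in>?K. (- 1) ^ card D)"
  proof (rule sum.cong)
    fix D assume "D \<in> ?K"
    then have "pred_on.chain P (<) D" using VP unfolding chain_less_iff by auto
    from sum_mobius_above_chain[OF fin this ends]
    show "(\<Sum>C | C \<in> ?B \<and> D \<subseteq> C. (- 1) ^ card D * ?l C) = (- 1) ^ card D"
      by (simp only: sum_distrib_left[symmetric] mult_1_right)
  qed simp
  finally show ?thesis .
qed

section \<open>The base polytope\<close>

context matroid
begin

section \<open>Greedy bases and minimization of linear functionals\<close>

text \<open>The basis of a prefix is extended, never exchanged, so it keeps attaining the rank of
  every earlier prefix.\<close>

lemma greedy_basis:
  assumes "set es \<subseteq> E"
  shows "\<exists>B\<in>\<I>. B \<subseteq> set es \<and> (\<forall>k. card (B \<inter> set (take k es)) = rank_of \<I> (set (take k es)))"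
  using assms
proof (induction es rule: rev_induct)
  case Nil
  show ?case using empty_indep rank_indep[OF empty_indep] by auto
next
  case (snoc e es)
  then obtain A where A: "A \<in> \<I>" "A \<subseteq> set es"
    "\<And>k. card (A \<inter> set (take k es)) = rank_of \<I> (set (take k es))" by auto
  obtain B where B: "B \<in> \<I>" "A \<subseteq> B" "B \<subseteq> set (es @ [e])" "card B = rank_of \<I> (set (es @ [e]))"
    using extend_indep[OF A(1), of "set (es @ [e])"] A(2) by auto
  have "card (B \<inter> set (take k (es @ [e]))) = rank_of \<I> (set (take k (es @ [e])))" for k
  proof (cases "k \<le> length es")
    case True
    have "card (A \<inter> set (take k es)) \<le> card (B \<inter> set (take k es))"
      using B(2) by (intro card_mono) auto
    moreover have "card (B \<inter> set (take k es)) \<le> rank_of \<I> (set (take k es))"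
      using indep_subset[OF B(1)] by (intro card_le_rank) auto
    ultimately show ?thesis using A(3)[of k] True by simp
  next
    case False
    then show ?thesis using B(3,4) by (simp add: Int_absorb2)
  qed
  then show ?case using B by blast
qed

end

text \<open>Summation by parts: raising the common weight of a nonpositive partial sum from
  \<open>w n\<close> to \<open>w (Suc n)\<close> can only lower the product.\<close>

lemma abel_sum_ge:
  fixes w d :: "nat \<Rightarrow> real"
  assumes "\<And>i. i < n \<Longrightarrow> w i \<le> w (Suc i)" "\<And>k. k \<le> n \<Longrightarrow> (\<Sum>i<k. d i) \<le> 0"
  shows "w n * (\<Sum>i<Suc n. d i) \<le> (\<Sum>i<Suc n. w i * d i)"
  using assms
proof (induction n)
  case (Suc n)
  have "w (Suc n) * (\<Sum>i<Suc n. d i) \<le> w n * (\<Sum>i<Suc n. d i)"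
    using Suc.prems(1)[of n] Suc.prems(2)[of "Suc n"] by (intro mult_right_mono_neg) auto
  also have "\<dots> \<le> (\<Sum>i<Suc n. w i * d i)" using Suc by simp
  finally show ?case by (simp add: algebra_simps)
qed simp

text \<open>Sort \<open>E\<close> by weight and take the greedy basis \<open>B\<close>. Since
  \<open>B\<close> attains the rank of each prefix, the partial sums of \<open>x\<close> minus the
  indicator of \<open>B\<close> are nonpositive, with total 0, and \<open>abel_sum_ge\<close>
  applies.\<close>

lemma (in matroid) greedy_basis_minimizes:
  fixes w x :: "'a \<Rightarrow> real"
  assumes le: "\<And>X. X \<subseteq> E \<Longrightarrow> sum x X \<le> rank_of \<I> X" and eq: "sum x E = rank_of \<I> E"
  shows "\<exists>B\<in>bases \<I>. sum w B \<le> (\<Sum>i\<in>E. w i * x i)"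
proof -
  obtain ds where ds: "set ds = E" "distinct ds" using finite_distinct_list[OF finite_ground] by blast
  define es where "es = sort_key w ds"
  have es: "set es = E" "distinct es" "sorted (map w es)" using ds unfolding es_def by auto
  obtain B where B: "B \<in> \<I>" "B \<subseteq> E"
    "\<And>k. card (B \<inter> set (take k es)) = rank_of \<I> (set (take k es))"
    using greedy_basis[of es] es(1) by auto
  have base: "B \<in> bases \<I>"
    using B(1) B(3)[of "length es"] Int_absorb2[OF B(2)] es(1) bases_iff by simp
  define d where "d = (\<lambda>i. x i - indicator B i)"
  have fin: "finite X" if "X \<subseteq> E" for X using that finite_ground finite_subset by blast
  have d: "sum d X = sum x X - card (B \<inter> X)" if "X \<subseteq> E" for X
    using fin[OF that] unfolding d_def by (simp add: sum_subtractf indicator_def sum_of_bool_eq Int_commute)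
  have nth: "(\<Sum>i<k. g (es ! i)) = sum g (set (take k es))" if "k \<le> length es" for k and g :: "'a \<Rightarrow> real"
  proof -
    have "inj_on ((!) es) {0..<k}" using that es(2) by (intro inj_on_nth) auto
    then show ?thesis
      using nth_image[OF that] by (metis (no_types, lifting) atLeast0LessThan comp_apply sum.cong sum.reindex)
  qed
  have partial: "(\<Sum>i<k. d (es ! i)) \<le> 0" if "k \<le> length es" for k
  proof -
    have sub: "set (take k es) \<subseteq> E" using set_take_subset es(1) by metis
    show ?thesis using nth[OF that, of d] d[OF sub] le[OF sub] B(3)[of k] by simp
  qed
  have total: "(\<Sum>i<length es. d (es ! i)) = 0"
    using nth[of "length es" d] d[of E] eq B(3)[of "length es"] es(1) by simp
  have "0 \<le> (\<Sum>i<length es. w (es ! i) * d (es ! i))"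
  proof (cases "length es")
    case (Suc n)
    have "w (es ! n) * (\<Sum>i<Suc n. d (es ! i)) \<le> (\<Sum>i<Suc n. w (es ! i) * d (es ! i))"
    proof (rule abel_sum_ge)
      show "w (es ! i) \<le> w (es ! Suc i)" if "i < n" for i
        using sorted_nth_mono[OF es(3), of i "Suc i"] that Suc by simp
      show "(\<Sum>i<k. d (es ! i)) \<le> 0" if "k \<le> n" for k
        using partial[of k] that Suc by simp
    qed
    then show ?thesis using total unfolding Suc by simp
  qed simp
  also have "\<dots> = (\<Sum>i\<in>E. w i * d i)"
    using nth[of "length es" "\<lambda>i. w i * d i"] es(1) by simp
  also have "\<dots> = (\<Sum>i\<in>E. w i * x i) - (\<Sum>i\<in>E. w i * indicator B i)"
    unfolding d_def by (simp add: right_diff_distrib sum_subtractf)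
  also have "(\<Sum>i\<in>E. w i * indicator B i) = sum w B"
  proof -
    have "{i \<in> E. i \<in> B} = B" using B(2) by auto
    then show ?thesis using finite_ground by (simp add: sum_mult_indicator)
  qed
  finally show ?thesis using base by auto
qed

text \<open>
  Edmonds' description. A point outside the hull is separated from it by a linear functional,
  and the greedy basis for that functional contradicts the separation.
\<close>

lemma mem_base_polytope_iff:
  fixes E :: "'n::finite set" and x :: "real ^ 'n"
  assumes "matroid E \<I>"
  shows "x \<in> base_polytope \<I> \<longleftrightarrow> (\<forall>i. 0 \<le> x $ i) \<and> (\<forall>i. i \<notin> E \<longrightarrow> x $ i = 0) \<and>
    (\<Sum>i\<in>E. x $ i) = rank_of \<I> E \<and> (\<forall>X\<subseteq>E. (\<Sum>i\<in>X. x $ i) \<le> rank_of \<I> X)"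
    (is "_ \<longleftrightarrow> ?Q x")
proof
  interpret matroid E \<I> by fact
  have "convex {x. ?Q x}"
  proof (rule convexI)
    fix x y :: "real ^ 'n" and u v :: real
    assume x: "x \<in> {x. ?Q x}" and y: "y \<in> {x. ?Q x}" and uv: "0 \<le> u" "0 \<le> v" "u + v = 1"
    have s: "(\<Sum>i\<in>X. (u *\<^sub>R x + v *\<^sub>R y) $ i) = u * (\<Sum>i\<in>X. x $ i) + v * (\<Sum>i\<in>X. y $ i)" for X
      by (simp add: sum.distrib sum_distrib_left)
    have "(\<Sum>i\<in>X. (u *\<^sub>R x + v *\<^sub>R y) $ i) \<le> rank_of \<I> X" if "X \<subseteq> E" for X
      unfolding s using that x y uv by (intro convex_bound_le) auto
    moreover have "(\<Sum>i\<in>E. (u *\<^sub>R x + v *\<^sub>R y) $ i) = rank_of \<I> E"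
      unfolding s using x y uv by (simp add: distrib_right[symmetric])
    ultimately show "u *\<^sub>R x + v *\<^sub>R y \<in> {x. ?Q x}"
      using x y uv by simp
  qed
  moreover have "(\<chi> i. indicator B i) \<in> {x. ?Q x}" if "B \<in> bases \<I>" for B
  proof -
    have B: "B \<in> \<I>" "card B = rank_of \<I> E" "B \<subseteq> E"
      using that bases_iff indep_subset_ground by auto
    have "(\<Sum>i\<in>X. indicator B i :: real) = card (X \<inter> B)" for X
      by (simp add: indicator_def sum_of_bool_eq)
    moreover have "card (X \<inter> B) \<le> rank_of \<I> X" for X
      using indep_subset[OF B(1)] by (intro card_le_rank) auto
    ultimately show ?thesis using B by (auto simp: Int_absorb1 Int_absorb2 indicator_def)
  qed
  ultimately have "base_polytope \<I> \<subseteq> {x. ?Q x}"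
    unfolding base_polytope_def by (intro hull_minimal) auto
  then show "?Q x" if "x \<in> base_polytope \<I>" using that by blast
next
  interpret matroid E \<I> by fact
  assume Q: "?Q x"
  show "x \<in> base_polytope \<I>"
  proof (rule ccontr)
    assume "x \<notin> base_polytope \<I>"
    moreover have "closed (base_polytope \<I>)" "convex (base_polytope \<I>)"
      unfolding base_polytope_def by (auto intro!: compact_imp_closed finite_imp_compact_convex_hull)
    ultimately obtain a b where ab: "inner a x < b" "\<And>y. y \<in> base_polytope \<I> \<Longrightarrow> b < inner a y"
      using separating_hyperplane_closed_point by metis
    obtain B where B: "B \<in> bases \<I>" "(\<Sum>i\<in>B. a $ i) \<le> (\<Sum>i\<in>E. a $ i * x $ i)"
      using greedy_basis_minimizes[of "($) x" "($) a"] Q by auto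
    have "(\<chi> i. indicator B i) \<in> base_polytope \<I>"
      using B(1) unfolding base_polytope_def by (intro hull_inc) auto
    then have "b < inner a (\<chi> i. indicator B i)" by (rule ab(2))
    also have "\<dots> = (\<Sum>i\<in>B. a $ i)"
      by (simp add: inner_vec_def sum_mult_indicator)
    also have "\<dots> \<le> (\<Sum>i\<in>E. a $ i * x $ i)" by (rule B(2))
    \<comment> \<open>Coordinates of \<open>x\<close> outside \<open>E\<close> vanish.\<close>
    also have "\<dots> = inner a x"
      unfolding inner_vec_def using Q by (auto intro!: sum.mono_neutral_left)
    finally show False using ab(1) by simp
  qed
qed

text \<open>For a set \<open>X\<close>, the cyclic flat \<open>K\<close> of
  \<open>cyclic_flat_rank_le\<close> reduces its inequality to the one for \<open>K\<close> and the
  bound 1 on each coordinate in \<open>X - K\<close>.\<close>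

lemma mem_base_polytope_iff_cyclic_flats:
  fixes E :: "'n::finite set" and x :: "real ^ 'n"
  assumes "matroid E \<I>"
  shows "x \<in> base_polytope \<I> \<longleftrightarrow> (\<forall>i. 0 \<le> x $ i \<and> x $ i \<le> 1) \<and> (\<forall>i. i \<notin> E \<longrightarrow> x $ i = 0) \<and>
    (\<Sum>i\<in>E. x $ i) = rank_of \<I> E \<and> (\<forall>F\<in>cyclic_flats E \<I>. (\<Sum>i\<in>F. x $ i) \<le> rank_of \<I> F)"
    (is "_ \<longleftrightarrow> ?R")
proof
  interpret matroid E \<I> by fact
  assume x: "x \<in> base_polytope \<I>"
  note Q = x[unfolded mem_base_polytope_iff[OF assms]]
  have "x $ i \<le> 1" for i
  proof (cases "i \<in> E")
    case True
    then have "(\<Sum>j\<in>{i}. x $ j) \<le> rank_of \<I> {i}" using Q by blast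
    also have "\<dots> \<le> 1" using rank_le_card[of "{i}"] by simp
    finally show ?thesis by simp
  qed (use Q in simp)
  then show ?R using Q cyclic_flat_subset_ground by blast
next
  interpret matroid E \<I> by fact
  assume R: ?R
  have "(\<Sum>i\<in>X. x $ i) \<le> rank_of \<I> X" if X: "X \<subseteq> E" for X
  proof -
    obtain K where K: "K \<in> cyclic_flats E \<I>" "rank_of \<I> K + card (X - K) \<le> rank_of \<I> X"
      using cyclic_flat_rank_le[OF X] .
    have "(\<Sum>i\<in>X. x $ i) \<le> (\<Sum>i\<in>K \<union> (X - K). x $ i)"
      using R by (intro sum_mono2) auto
    also have "\<dots> = (\<Sum>i\<in>K. x $ i) + (\<Sum>i\<in>X - K. x $ i)"
      by (rule sum.union_disjoint) auto
    also have "(\<Sum>i\<in>X - K. x $ i) \<le> (\<Sum>i\<in>X - K. 1)"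
      using R by (intro sum_mono) simp
    also have "(\<Sum>i\<in>K. x $ i) + (\<Sum>i\<in>X - K. 1) \<le> rank_of \<I> K + card (X - K)"
      using R K(1) by simp
    also have "\<dots> \<le> rank_of \<I> X" using K(2) by linarith
    finally show ?thesis by simp
  qed
  then show "x \<in> base_polytope \<I>" using R mem_base_polytope_iff[OF assms] by blast
qed

text \<open>
  Submodularity of \<open>rank_of \<I> X - sum x X\<close>: joining with a minimizer \<open>m\<close> over the cyclic flats
  cannot increase it, so the violated cyclic flats are closed under joins with \<open>m\<close>.
\<close>

lemma (in matroid) slack_join_minimizer:
  fixes x :: "'a \<Rightarrow> real"
  assumes x: "\<And>i. 0 \<le> x i" "\<And>i. x i \<le> 1"
    and F: "F \<in> cyclic_flats E \<I>" and m: "m \<in> cyclic_flats E \<I>"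
    and min: "\<And>G. G \<in> cyclic_flats E \<I> \<Longrightarrow> rank_of \<I> m - sum x m \<le> rank_of \<I> G - sum x G"
  shows "rank_of \<I> (matroid_closure (F \<union> m)) - sum x (matroid_closure (F \<union> m))
    \<le> rank_of \<I> F - sum x F"
proof -
  have FE: "F \<subseteq> E" and mE: "m \<subseteq> E" using F m cyclic_flat_subset_ground by auto
  then have U: "F \<union> m \<subseteq> E" and I: "F \<inter> m \<subseteq> E" by auto
  have fin: "finite X" if "X \<subseteq> E" for X using that finite_ground finite_subset by blast
  \<comment> \<open>\<open>F \<inter> m\<close> need not be a cyclic flat; \<open>K\<close> is one
    whose slack is no larger, so the minimality of \<open>m\<close> can be used.\<close>
  obtain K where K: "K \<in> cyclic_flats E \<I>" "rank_of \<I> K + card (F \<inter> m - K) \<le> rank_of \<I> (F \<inter> m)"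
    using cyclic_flat_rank_le[OF I] .
  have KE: "K \<subseteq> E" using K(1) by (rule cyclic_flat_subset_ground)
  have "sum x (F \<inter> m) \<le> sum x (K \<union> (F \<inter> m - K))"
    using x fin KE I by (intro sum_mono2) auto
  also have "\<dots> = sum x K + sum x (F \<inter> m - K)"
    using fin KE FE by (intro sum.union_disjoint) auto
  also have "sum x (F \<inter> m - K) \<le> (\<Sum>i\<in>F \<inter> m - K. 1)"
    using x by (intro sum_mono) simp
  finally have meet: "rank_of \<I> K - sum x K \<le> rank_of \<I> (F \<inter> m) - sum x (F \<inter> m)"
    using K(2) by simp
  \<comment> \<open>Taking the closure keeps the rank and cannot decrease the coordinate
    sum.\<close>
  have "sum x (F \<union> m) \<le> sum x (matroid_closure (F \<union> m))"
    using x subset_matroid_closure[OF U] fin[of "matroid_closure (F \<union> m)"]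
    by (intro sum_mono2) (auto simp: matroid_closure_def)
  then show ?thesis
    using rank_matroid_closure[OF U] rank_submodular[of F m] min[OF K(1)] meet
      sum.union_inter[of F m x] fin[OF FE] fin[OF mE] by simp
qed

theorem theorem2p13:
  fixes E :: "'n::finite set" and \<I> :: "'n set set" and r :: nat
  assumes "matroid E \<I>" and "rank_of \<I> E = r"
  shows "(indicator (base_polytope \<I>) :: real ^ 'n \<Rightarrow> int) =
    (\<lambda>x. \<Sum>C\<in>bounded_chains (cyclic_flats E \<I>).
      lam E \<I> C * indicator (base_polytope (schubert E \<I> C)) x)"
proof
  interpret matroid E \<I> by fact
  fix x :: "real ^ 'n"
  let ?Z = "cyclic_flats E \<I>"
  define V where "V = {F \<in> ?Z. rank_of \<I> F < (\<Sum>i\<in>F. x $ i)}"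
  \<comment> \<open>These conditions are the same for the given matroid and for all
    \<open>schubert E \<I> C\<close>; where they fail, both sides are 0.\<close>
  define Q where "Q \<longleftrightarrow> (\<forall>i. 0 \<le> x $ i \<and> x $ i \<le> 1) \<and> (\<forall>i. i \<notin> E \<longrightarrow> x $ i = 0) \<and>
    (\<Sum>i\<in>E. x $ i) = rank_of \<I> E"
  have mem: "x \<in> base_polytope \<I> \<longleftrightarrow> Q \<and> V = {}"
    unfolding mem_base_polytope_iff_cyclic_flats[OF assms(1)] Q_def V_def by force
  have mem_schubert: "x \<in> base_polytope (schubert E \<I> C) \<longleftrightarrow> Q \<and> C \<inter> V = {}"
    if C: "C \<in> bounded_chains ?Z" for C
  proof -
    have "C \<subseteq> ?Z" by (rule bounded_chain_subset[OF C])
    then show ?thesis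
      unfolding mem_base_polytope_iff_cyclic_flats[OF matroid_schubert[OF C]] Q_def V_def
      by (auto simp: cyclic_flats_schubert[OF C] rank_schubert[OF C] rank_schubert_ground[OF C]
          disjoint_iff not_less subset_iff)
  qed
  have "indicator (base_polytope \<I>) x
      = (\<Sum>C\<in>bounded_chains ?Z. if Q \<and> C \<inter> V = {} then lam E \<I> C else 0)"
  proof (cases Q)
    case Q: True
    obtain a b where ends: "a \<in> ?Z" "\<And>p. p \<in> ?Z \<Longrightarrow> a \<le> p" "b \<in> ?Z" "\<And>p. p \<in> ?Z \<Longrightarrow> p \<le> b"
      by (metis cyclic_flats_least cyclic_flats_greatest)
    have VZ: "V \<subseteq> ?Z" and finV: "finite V"
      using finite_cyclic_flats unfolding V_def by auto
    have "(\<Sum>C\<in>bounded_chains ?Z. if Q \<and> C \<inter> V = {} then lam E \<I> C else 0)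
        = (\<Sum>C | C \<in> bounded_chains ?Z \<and> C \<inter> V = {}. lam E \<I> C)"
      using Q finite_bounded_chains[OF finite_cyclic_flats] by (simp add: sum.inter_filter)
    also have "\<dots> = (\<Sum>D | pred_on.chain V (<) D. (- 1) ^ card D)"
      unfolding lam_def using finite_cyclic_flats VZ ends by (rule sum_mobius_chains_avoiding)
    also have "\<dots> = (if V = {} then 1 else 0)"
    proof (cases "V = {}")
      case True
      then have "{D. pred_on.chain V (<) D} = {{}}" unfolding chain_less_iff by auto
      then show ?thesis using True by simp
    next
      case False
      define f where "f = (\<lambda>F. rank_of \<I> F - (\<Sum>i\<in>F. x $ i))"
      have "finite (f ` ?Z)" "f ` ?Z \<noteq> {}" using finite_cyclic_flats ends(1) by auto
      then obtain m where m: "m \<in> ?Z" "\<And>F. F \<in> ?Z \<Longrightarrow> f m \<le> f F"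
        using Min_in[of "f ` ?Z"] Min_le[of "f ` ?Z"] by (metis (no_types, lifting) imageE imageI)
      have V: "F \<in> V \<longleftrightarrow> F \<in> ?Z \<and> f F < 0" for F unfolding V_def f_def by auto
      have UE: "p \<union> m \<subseteq> E" if "p \<in> ?Z" for p
        using that m(1) cyclic_flat_subset_ground by blast
      have "(\<Sum>D | pred_on.chain V (<) D. (- 1) ^ card D) = (0 :: int)"
      proof (rule alternating_sum_chains_eq_0[where m = m and j = "\<lambda>p. matroid_closure (p \<union> m)"])
        \<comment> \<open>Some slack is negative, hence so is the minimal one.\<close>
        obtain F where "F \<in> V" using False by blast
        then show "m \<in> V" using m V by fastforce
        show "matroid_closure (p \<union> m) \<in> V" if "p \<in> V" for p
        proof -
          have "f (matroid_closure (p \<union> m)) \<le> f p"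
            unfolding f_def using Q that V m
            by (intro slack_join_minimizer) (auto simp: Q_def f_def)
          then show ?thesis using that V m(1) matroid_closure_Un_cyclic_flat by force
        qed
        show "p \<le> matroid_closure (p \<union> m)" "m \<le> matroid_closure (p \<union> m)" if "p \<in> V" for p
          using subset_matroid_closure[OF UE[of p]] that V by auto
        show "matroid_closure (p \<union> m) \<le> q" if "q \<in> V" "p \<le> q" "m \<le> q" for p q
          using that V by (intro matroid_closure_least) (auto simp: cyclic_flats_def)
      qed (rule finV)
      then show ?thesis using False by simp
    qed
    finally show ?thesis using Q mem by (simp add: indicator_def)
  qed (simp add: mem)
  also have "\<dots> = (\<Sum>C\<in>bounded_chains ?Z. lam E \<I> C * indicator (base_polytope (schubert E \<I> C)) x)"
    by (rule sum.cong) (auto simp: mem_schubert indicator_def)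
  finally show "indicator (base_polytope \<I>) x =
    (\<Sum>C\<in>bounded_chains ?Z. lam E \<I> C * indicator (base_polytope (schubert E \<I> C)) x)" .
qed

end
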